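(* Let $C=(C_p,d_p,\beta_p)_{p\in\mathbb Z}$ be an algebraic cellular complex (the distinguished bases $\beta_p$ need not be finite) and let $V=\{(\sigma_i,\tau_i)\}_{i\in\beta}$ be an admissible discrete vector field on $C$. Then $V$ defines a canonical reduction $\rho=(f,g,h)$ from the chain complex $(C_p,d_p)_p$ to a chain complex $(C^c_p,d'_p)_p$, where $C^c_p=\mathbb Z[\beta^c_p]$ is the free $\mathbb Z$-module generated by the set $\beta^c_p$ of critical $p$-cells of $V$.
   Context: An algebraic cellular complex $C=(C_p,d_p,\beta_p)_{p\in\mathbb Z}$ is a chain complex of free $\mathbb Z$-modules $C_p$ with differentials $d_p:C_p\to C_{p-1}$, $d_{p-1}d_p=0$, each $C_p$ having a distinguished basis $\beta_p$ (possibly infinite), whose elements are called $p$-cells. A $(p-1)$-cell $\sigma$ is a face of a $p$-cell $\tau$ if the coefficient of $\sigma$ in $d\tau$ is nonzero; it is a regular face if this coefficient is $\pm1$. A discrete vector field on $C$ is a collection of pairs $V=\{(\sigma_i,\tau_i)\}_{i\in\beta}$ such that each $\sigma_i$ is a $p$-cell and $\tau_i$ a $(p+1)$-cell ($p$ may depend on $i$), $\sigma_i$ is a regular face of $\tau_i$, and every cell of $C$ appears at most once in $V$ (as a $\sigma_i$ or as a $\tau_i$). A cell not appearing in $V$ is critical. A $V$-path of degree $p$ and length $m$ is a sequence $((\sigma_{i_k},\tau_{i_k}))_{0\le k<m}$ of elements of $V$ with each $\tau_{i_k}$ a $p$-cell, such that for $0<k<m$ the cell $\sigma_{i_k}$ is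 a face (not necessarily regular) of $\tau_{i_{k-1}}$ different from $\sigma_{i_{k-1}}$; it starts from $\sigma_{i_0}$. $V$ is admissible if for every $p$ there is a function $\lambda_p:\beta_p\to\mathbb N$ such that every $V$-path starting from $\sigma\in\beta_p$ has length at most $\lambda_p(\sigma)$. A reduction $\rho=(f,g,h)$ from a chain complex $\widehat C_*$ to a chain complex $C_*$ consists of chain maps $f:\widehat C_*\to C_*$, $g:C_*\to\widehat C_*$ and a degree $+1$ operator $h:\widehat C_*\to\widehat C_{*+1}$ with $fg=\mathrm{id}_{C_*}$, $gf+dh+hd=\mathrm{id}_{\widehat C_*}$, $fh=0$, $hg=0$, $hh=0$. *)

theory Defs
  imports "HOL-Algebra.Free_Abelian_Groups"
begin

section \<open>Chain complexes and reductions\<close>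

text \<open>
  Chain complexes of Z-modules are families of abelian groups indexed by all integers. The groups
  are written multiplicatively, as everywhere in HOL-Algebra; in a free abelian group the
  operation and its unit unfold to \<open>+\<close> and \<open>0\<close>. A map indexed by \<open>p\<close> has its source in degree \<open>p\<close>,
  and only its values on the carrier of that source are meaningful.
\<close>

definition chain_complex :: "(int \<Rightarrow> 'a monoid) \<Rightarrow> (int \<Rightarrow> 'a \<Rightarrow> 'a) \<Rightarrow> bool" where
  "chain_complex C d \<longleftrightarrow>
     (\<forall>p. comm_group (C p) \<and> d p \<in> hom (C p) (C (p - 1)) \<and>
          (\<forall>x \<in> carrier (C p). d (p - 1) (d p x) = \<one>\<^bsub>C (p - 2)\<^esub>))"

definition chain_map ::
  "(int \<Rightarrow> 'a monoid) \<Rightarrow> (int \<Rightarrow> 'a \<Rightarrow> 'a) \<Rightarrow> (int \<Rightarrow> 'b monoid) \<Rightarrow> (int \<Rightarrow> 'b \<Rightarrow> 'b) \<Rightarrow>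
   (int \<Rightarrow> 'a \<Rightarrow> 'b) \<Rightarrow> bool" where
  "chain_map C d D e f \<longleftrightarrow>
     (\<forall>p. f p \<in> hom (C p) (D p) \<and> (\<forall>x \<in> carrier (C p). f (p - 1) (d p x) = e p (f p x)))"

definition reduction ::
  "(int \<Rightarrow> 'a monoid) \<Rightarrow> (int \<Rightarrow> 'a \<Rightarrow> 'a) \<Rightarrow> (int \<Rightarrow> 'b monoid) \<Rightarrow> (int \<Rightarrow> 'b \<Rightarrow> 'b) \<Rightarrow>
   (int \<Rightarrow> 'a \<Rightarrow> 'b) \<Rightarrow> (int \<Rightarrow> 'b \<Rightarrow> 'a) \<Rightarrow> (int \<Rightarrow> 'a \<Rightarrow> 'a) \<Rightarrow> bool" where
  "reduction C d D e f g h \<longleftrightarrow>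
     chain_complex C d \<and> chain_complex D e \<and>
     chain_map C d D e f \<and> chain_map D e C d g \<and>
     (\<forall>p. h p \<in> hom (C p) (C (p + 1))) \<and>
     (\<forall>p. \<forall>y \<in> carrier (D p). f p (g p y) = y) \<and>
     (\<forall>p. \<forall>x \<in> carrier (C p).
        g p (f p x) \<otimes>\<^bsub>C p\<^esub> d (p + 1) (h p x) \<otimes>\<^bsub>C p\<^esub> h (p - 1) (d p x) = x) \<and>
     (\<forall>p. \<forall>x \<in> carrier (C p). f (p + 1) (h p x) = \<one>\<^bsub>D (p + 1)\<^esub>) \<and>
     (\<forall>p. \<forall>y \<in> carrier (D p). h p (g p y) = \<one>\<^bsub>C (p + 1)\<^esub>) \<and>
     (\<forall>p. \<forall>x \<in> carrier (C p). h (p + 1) (h p x) = \<one>\<^bsub>C (p + 2)\<^esub>)"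


section \<open>Algebraic cellular complexes\<close>

text \<open>
  A free Z-module with distinguished basis \<open>\<beta> p\<close> is taken to be \<open>free_Abelian_group (\<beta> p)\<close>, whose
  basis vectors are \<open>frag_of \<sigma>\<close> for \<open>\<sigma> \<in> \<beta> p\<close>. The sets \<open>\<beta> p\<close> are arbitrary. They are not required
  to be disjoint for different \<open>p\<close>: a cell is an element together with its degree.
\<close>

definition algebraic_cellular_complex ::
  "(int \<Rightarrow> 'a set) \<Rightarrow> (int \<Rightarrow> ('a \<Rightarrow>\<^sub>0 int) \<Rightarrow> ('a \<Rightarrow>\<^sub>0 int)) \<Rightarrow> bool" where
  "algebraic_cellular_complex \<beta> d \<longleftrightarrow> chain_complex (\<lambda>p. free_Abelian_group (\<beta> p)) d"

definition face ::
  "(int \<Rightarrow> 'a set) \<Rightarrow> (int \<Rightarrow> ('a \<Rightarrow>\<^sub>0 int) \<Rightarrow> ('a \<Rightarrow>\<^sub>0 int)) \<Rightarrow> int \<Rightarrow> 'a \<Rightarrow> 'a \<Rightarrow> bool" where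
  "face \<beta> d p \<sigma> \<tau> \<longleftrightarrow>
     \<sigma> \<in> \<beta> (p - 1) \<and> \<tau> \<in> \<beta> p \<and> Poly_Mapping.lookup (d p (frag_of \<tau>)) \<sigma> \<noteq> 0"

definition regular_face ::
  "(int \<Rightarrow> 'a set) \<Rightarrow> (int \<Rightarrow> ('a \<Rightarrow>\<^sub>0 int) \<Rightarrow> ('a \<Rightarrow>\<^sub>0 int)) \<Rightarrow> int \<Rightarrow> 'a \<Rightarrow> 'a \<Rightarrow> bool" where
  "regular_face \<beta> d p \<sigma> \<tau> \<longleftrightarrow>
     \<sigma> \<in> \<beta> (p - 1) \<and> \<tau> \<in> \<beta> p \<and> Poly_Mapping.lookup (d p (frag_of \<tau>)) \<sigma> \<in> {1, - 1}"


section \<open>Discrete vector fields\<close>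

text \<open>
  A vector field is split by degree: \<open>V p\<close> is the set of its pairs \<open>(\<sigma>, \<tau>)\<close> with \<open>\<sigma>\<close> a \<open>p\<close>-cell and
  \<open>\<tau>\<close> a \<open>(p + 1)\<close>-cell. Hence the \<open>p\<close>-cells occurring as a first component are \<open>Domain (V p)\<close>, and
  those occurring as a second component are \<open>Range (V (p - 1))\<close>. The last three conditions say
  that no cell occurs twice.
\<close>

definition discrete_vector_field ::
  "(int \<Rightarrow> 'a set) \<Rightarrow> (int \<Rightarrow> ('a \<Rightarrow>\<^sub>0 int) \<Rightarrow> ('a \<Rightarrow>\<^sub>0 int)) \<Rightarrow> (int \<Rightarrow> ('a \<times> 'a) set) \<Rightarrow> bool" where
  "discrete_vector_field \<beta> d V \<longleftrightarrow>
     (\<forall>p. (\<forall>(\<sigma>, \<tau>) \<in> V p. \<sigma> \<in> \<beta> p \<and> \<tau> \<in> \<beta> (p + 1) \<and> regular_face \<beta> d (p + 1) \<sigma> \<tau>) \<and>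
          (\<forall>\<sigma> \<tau> \<tau>'. (\<sigma>, \<tau>) \<in> V p \<longrightarrow> (\<sigma>, \<tau>') \<in> V p \<longrightarrow> \<tau> = \<tau>') \<and>
          (\<forall>\<sigma> \<sigma>' \<tau>. (\<sigma>, \<tau>) \<in> V p \<longrightarrow> (\<sigma>', \<tau>) \<in> V p \<longrightarrow> \<sigma> = \<sigma>') \<and>
          Domain (V p) \<inter> Range (V (p - 1)) = {})"

definition critical_cells ::
  "(int \<Rightarrow> 'a set) \<Rightarrow> (int \<Rightarrow> ('a \<times> 'a) set) \<Rightarrow> int \<Rightarrow> 'a set" where
  "critical_cells \<beta> V p = \<beta> p - Domain (V p) - Range (V (p - 1))"

definition V_path ::
  "(int \<Rightarrow> 'a set) \<Rightarrow> (int \<Rightarrow> ('a \<Rightarrow>\<^sub>0 int) \<Rightarrow> ('a \<Rightarrow>\<^sub>0 int)) \<Rightarrow> (int \<Rightarrow> ('a \<times> 'a) set) \<Rightarrow>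
   int \<Rightarrow> ('a \<times> 'a) list \<Rightarrow> bool" where
  "V_path \<beta> d V p \<pi> \<longleftrightarrow>
     set \<pi> \<subseteq> V (p - 1) \<and>
     (\<forall>k. 0 < k \<and> k < length \<pi> \<longrightarrow>
        face \<beta> d p (fst (\<pi> ! k)) (snd (\<pi> ! (k - 1))) \<and> fst (\<pi> ! k) \<noteq> fst (\<pi> ! (k - 1)))"

text \<open>A path starting from a \<open>p\<close>-cell has degree \<open>p + 1\<close>, the degree being that of the \<open>\<tau>\<close>'s.\<close>

definition admissible ::
  "(int \<Rightarrow> 'a set) \<Rightarrow> (int \<Rightarrow> ('a \<Rightarrow>\<^sub>0 int) \<Rightarrow> ('a \<Rightarrow>\<^sub>0 int)) \<Rightarrow> (int \<Rightarrow> ('a \<times> 'a) set) \<Rightarrow> bool" where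
  "admissible \<beta> d V \<longleftrightarrow>
     (\<forall>p. \<exists>bound :: 'a \<Rightarrow> nat. \<forall>\<sigma> \<in> \<beta> p. \<forall>\<pi>.
        V_path \<beta> d V (p + 1) \<pi> \<and> \<pi> \<noteq> [] \<and> fst (hd \<pi>) = \<sigma> \<longrightarrow> length \<pi> \<le> bound \<sigma>)"


section \<open>The reduction defined by a vector field\<close>

text \<open>
  The vector field splits the cells into sources (first components), targets (second components)
  and critical cells. A reduction onto the critical complex is defined by \<open>V\<close> if it respects this
  splitting: \<open>h\<close> sends sources to combinations of targets and vanishes on all other cells, \<open>f\<close> is
  the identity on critical cells and vanishes on targets, and \<open>g\<close> alters a critical cell only by
  targets. Writing \<open>d\<^sub>t\<^sub>s\<close> for the block of \<open>d\<close> from targets to sources, and \<open>pr\<close> for the projection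
  onto critical cells, these conditions and the reduction identities force \<open>h = d\<^sub>t\<^sub>s\<^sup>-\<^sup>1\<close> on sources,
  \<open>f = pr (1 - d h)\<close>, \<open>g = 1 - h d\<close> on critical cells, and \<open>d' = pr d g\<close>.
\<close>

definition vector_field_reduction ::
  "(int \<Rightarrow> 'a set) \<Rightarrow> (int \<Rightarrow> ('a \<Rightarrow>\<^sub>0 int) \<Rightarrow> ('a \<Rightarrow>\<^sub>0 int)) \<Rightarrow> (int \<Rightarrow> ('a \<times> 'a) set) \<Rightarrow>
   (int \<Rightarrow> ('a \<Rightarrow>\<^sub>0 int) \<Rightarrow> ('a \<Rightarrow>\<^sub>0 int)) \<Rightarrow> (int \<Rightarrow> ('a \<Rightarrow>\<^sub>0 int) \<Rightarrow> ('a \<Rightarrow>\<^sub>0 int)) \<Rightarrow>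
   (int \<Rightarrow> ('a \<Rightarrow>\<^sub>0 int) \<Rightarrow> ('a \<Rightarrow>\<^sub>0 int)) \<Rightarrow> (int \<Rightarrow> ('a \<Rightarrow>\<^sub>0 int) \<Rightarrow> ('a \<Rightarrow>\<^sub>0 int)) \<Rightarrow> bool" where
  "vector_field_reduction \<beta> d V d' f g h \<longleftrightarrow>
     reduction (\<lambda>p. free_Abelian_group (\<beta> p)) d
               (\<lambda>p. free_Abelian_group (critical_cells \<beta> V p)) d' f g h \<and>
     (\<forall>p. (\<forall>\<sigma> \<in> Domain (V p). Poly_Mapping.keys (h p (frag_of \<sigma>)) \<subseteq> Range (V p)) \<and>
          (\<forall>x \<in> \<beta> p - Domain (V p). h p (frag_of x) = 0) \<and>
          (\<forall>\<tau> \<in> Range (V (p - 1)). f p (frag_of \<tau>) = 0) \<and>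
          (\<forall>c \<in> critical_cells \<beta> V p. f p (frag_of c) = frag_of c) \<and>
          (\<forall>c \<in> critical_cells \<beta> V p.
             Poly_Mapping.keys (g p (frag_of c) - frag_of c) \<subseteq> Range (V (p - 1))))"

end

theory Submission
  imports Defs
begin

text \<open>
  Admissibility makes the block of \<open>d\<close> from targets to sources triangular with diagonal \<open>\<plusminus>1\<close> for a
  well-founded order on the sources, so it has an inverse \<open>h\<close>, defined by well-founded recursion.
  Extended by \<open>0\<close> to the other cells, \<open>h\<close> satisfies \<open>h h = 0\<close> and \<open>h d h = h\<close>, hence
  \<open>\<pi> = 1 - d h - h d\<close> is a projector commuting with \<open>d\<close>. An element in the image of \<open>\<pi>\<close> has no source
  component and is killed by \<open>h d\<close>, so it is determined by its critical component; this identifies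
  the image with the critical complex. Conversely, in any reduction defined by \<open>V\<close> the source
  component of the homotopy identity forces \<open>h\<close>, and \<open>h\<close> determines \<open>g f = \<pi>\<close>.
\<close>

section \<open>Free abelian groups\<close>

definition frag_proj :: "'a set \<Rightarrow> ('a \<Rightarrow>\<^sub>0 int) \<Rightarrow> ('a \<Rightarrow>\<^sub>0 int)" where
  "frag_proj A = frag_extend (\<lambda>a. if a \<in> A then frag_of a else 0)"

lemma lookup_frag_proj:
  "Poly_Mapping.lookup (frag_proj A x) a = (if a \<in> A then Poly_Mapping.lookup x a else 0)"
  using subset_UNIV
  by (induction x rule: frag_induction) (auto simp: frag_proj_def frag_extend_diff lookup_minus)

lemma keys_frag_proj [simp]: "Poly_Mapping.keys (frag_proj A x) = Poly_Mapping.keys x \<inter> A"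
  by (auto simp: in_keys_iff lookup_frag_proj split: if_splits)

lemma frag_proj_0 [simp]: "frag_proj A 0 = 0"
  by (simp add: frag_proj_def)

lemma frag_proj_add: "frag_proj A (x + y) = frag_proj A x + frag_proj A y"
  by (simp add: frag_proj_def frag_extend_add)

lemma frag_proj_diff: "frag_proj A (x - y) = frag_proj A x - frag_proj A y"
  by (simp add: frag_proj_def frag_extend_diff)

lemma frag_proj_frag_of: "frag_proj A (frag_of a) = (if a \<in> A then frag_of a else 0)"
  by (simp add: frag_proj_def)

lemma frag_proj_id: "Poly_Mapping.keys x \<subseteq> A \<Longrightarrow> frag_proj A x = x"
  by (rule poly_mapping_eqI) (auto simp: lookup_frag_proj in_keys_iff)

lemma frag_proj_eq_0: "Poly_Mapping.keys x \<inter> A = {} \<Longrightarrow> frag_proj A x = 0"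
  by (rule poly_mapping_eqI) (auto simp: lookup_frag_proj in_keys_iff)

lemma frag_proj_Un:
  "A \<inter> B = {} \<Longrightarrow> frag_proj (A \<union> B) x = frag_proj A x + frag_proj B x"
  by (rule poly_mapping_eqI) (auto simp: lookup_frag_proj lookup_add)

lemma frag_proj_remove:
  assumes "a \<in> A"
  shows "frag_proj A x
    = frag_cmul (Poly_Mapping.lookup x a) (frag_of a) + frag_proj (A - {a}) x"
  by (rule poly_mapping_eqI) (use assms in \<open>auto simp: lookup_frag_proj lookup_add\<close>)

lemma frag_extend_in_hom:
  assumes "\<And>a. a \<in> A \<Longrightarrow> Poly_Mapping.keys (\<phi> a) \<subseteq> B"
  shows "frag_extend \<phi> \<in> hom (free_Abelian_group A) (free_Abelian_group B)"
proof (rule homI)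
  fix x assume "x \<in> carrier (free_Abelian_group A)"
  then show "frag_extend \<phi> x \<in> carrier (free_Abelian_group B)"
    using keys_frag_extend[of \<phi> x] assms by fastforce
qed (simp add: frag_extend_add)

lemmas frag_induct = free_Abelian_group_induct[consumes 1, case_names zero diff frag_of]

lemma hom_free_Abelian_group_0:
  assumes "\<phi> \<in> hom (free_Abelian_group A) (free_Abelian_group B)"
  shows "\<phi> 0 = 0"
  using hom_frag_diff[OF assms, of 0 0] by simp

lemma hom_free_Abelian_group_eqI:
  assumes "\<phi> \<in> hom (free_Abelian_group A) (free_Abelian_group B)"
    and "\<psi> \<in> hom (free_Abelian_group A) (free_Abelian_group B')"
    and "\<And>a. a \<in> A \<Longrightarrow> \<phi> (frag_of a) = \<psi> (frag_of a)"
    and "Poly_Mapping.keys x \<subseteq> A"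
  shows "\<phi> x = \<psi> x"
  using assms(4)
proof (induction x rule: frag_induct)
  case zero
  then show ?case
    using assms(1,2) by (simp add: hom_free_Abelian_group_0)
next
  case (diff x y)
  then show ?case
    using hom_frag_diff[OF assms(1)] hom_frag_diff[OF assms(2)] by simp
next
  case (frag_of a)
  then show ?case
    by (rule assms(3))
qed


section \<open>Inverting the block of the differential from targets to sources\<close>

locale vector_field_complex =
  fixes \<beta> :: "int \<Rightarrow> 'a set"
    and d :: "int \<Rightarrow> ('a \<Rightarrow>\<^sub>0 int) \<Rightarrow> ('a \<Rightarrow>\<^sub>0 int)"
    and V :: "int \<Rightarrow> ('a \<times> 'a) set"
  assumes complex: "algebraic_cellular_complex \<beta> d"
    and field: "discrete_vector_field \<beta> d V"
    and admissible: "admissible \<beta> d V"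
begin

section \<open>Decomposition of the cells into sources, targets and critical cells\<close>

definition sources :: "int \<Rightarrow> 'a set" where "sources p = Domain (V p)"

definition targets :: "int \<Rightarrow> 'a set" where "targets p = Range (V (p - 1))"

definition critical :: "int \<Rightarrow> 'a set" where "critical p = critical_cells \<beta> V p"

definition partner :: "int \<Rightarrow> 'a \<Rightarrow> 'a" where "partner p \<sigma> = (THE \<tau>. (\<sigma>, \<tau>) \<in> V p)"

lemma partner_eq: "(\<sigma>, \<tau>) \<in> V p \<Longrightarrow> partner p \<sigma> = \<tau>"
  using field unfolding partner_def discrete_vector_field_def by (intro the_equality) blast+

lemma cells_eq: "\<beta> p = (sources p \<union> targets p) \<union> critical p"
proof -
  have "\<forall>(\<sigma>, \<tau>) \<in> V q. \<sigma> \<in> \<beta> q \<and> \<tau> \<in> \<beta> (q + 1)" for q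
    using field unfolding discrete_vector_field_def by blast
  \<comment> \<open>Degree p supplies the sources among the p-cells, degree p - 1 the
    targets.\<close>
  from this[of p] this[of "p - 1"] show ?thesis
    unfolding sources_def targets_def critical_def critical_cells_def by auto
qed

lemma disjoint:
  "sources p \<inter> targets p = {}" "(sources p \<union> targets p) \<inter> critical p = {}"
  using field
  unfolding discrete_vector_field_def sources_def targets_def critical_def critical_cells_def
  by auto

text \<open>The differential is extended to a total map so that it is additive without side conditions.\<close>

definition D :: "int \<Rightarrow> ('a \<Rightarrow>\<^sub>0 int) \<Rightarrow> ('a \<Rightarrow>\<^sub>0 int)" where
  "D p x = frag_extend (\<lambda>a. d p (frag_of a)) (frag_proj (\<beta> p) x)"

lemma d_hom: "d p \<in> hom (free_Abelian_group (\<beta> p)) (free_Abelian_group (\<beta> (p - 1)))"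
  using complex unfolding algebraic_cellular_complex_def chain_complex_def by blast

lemma keys_d: "Poly_Mapping.keys x \<subseteq> \<beta> p \<Longrightarrow> Poly_Mapping.keys (d p x) \<subseteq> \<beta> (p - 1)"
  using hom_in_carrier[OF d_hom] by simp

lemma D_eq_d:
  assumes "Poly_Mapping.keys x \<subseteq> \<beta> p" shows "D p x = d p x"
proof -
  have "frag_extend (\<lambda>a. d p (frag_of a)) x = d p x"
    by (rule hom_free_Abelian_group_eqI[OF frag_extend_in_hom d_hom _ assms]) (auto simp: keys_d)
  then show ?thesis
    using assms by (simp add: D_def frag_proj_id)
qed

lemma D_additive: "D p 0 = 0" "D p (x + y) = D p x + D p y" "D p (x - y) = D p x - D p y"
  by (simp_all add: D_def frag_proj_add frag_proj_diff frag_extend_add frag_extend_diff)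

lemma D_eq_d_proj: "D p x = d p (frag_proj (\<beta> p) x)"
proof -
  have "D p x = D p (frag_proj (\<beta> p) x)"
    by (simp add: D_def frag_proj_id[of "frag_proj (\<beta> p) x"])
  then show ?thesis
    by (simp add: D_eq_d)
qed

lemma keys_D: "Poly_Mapping.keys (D p x) \<subseteq> \<beta> (p - 1)"
  by (simp add: D_eq_d_proj keys_d)

text \<open>The second form has the index \<open>p + 1 - 1\<close> already simplified to
  \<open>p\<close>.\<close>

lemma D_D: "D (p - 1) (D p x) = 0" "D p (D (p + 1) x) = 0"
proof -
  have dd: "d (q - 1) (d q x) = 0" if "Poly_Mapping.keys x \<subseteq> \<beta> q" for q x
    using complex that unfolding algebraic_cellular_complex_def chain_complex_def by simp
  have *: "D (q - 1) (D q x) = 0" for q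
    using D_eq_d[OF keys_D, of q x] by (simp add: D_eq_d_proj[of q] dd)
  show "D (p - 1) (D p x) = 0" "D p (D (p + 1) x) = 0"
    using *[of p] *[of "p + 1"] by simp_all
qed

section \<open>The order on sources traced out by V-paths\<close>

definition step :: "int \<Rightarrow> ('a \<times> 'a) set" where
  "step p = {(\<sigma>', \<sigma>). \<sigma> \<in> sources p \<and> \<sigma>' \<in> sources p \<and> \<sigma>' \<noteq> \<sigma> \<and>
     Poly_Mapping.lookup (D (p + 1) (frag_of (partner p \<sigma>))) \<sigma>' \<noteq> 0}"

lemma source_pair: "\<sigma> \<in> sources p \<Longrightarrow> (\<sigma>, partner p \<sigma>) \<in> V p"
  by (auto simp: sources_def partner_eq)

lemma partner_in_targets: "\<sigma> \<in> sources p \<Longrightarrow> partner p \<sigma> \<in> targets (p + 1)"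
  using source_pair unfolding targets_def by auto

text \<open>Cells related by \<open>step p\<close> belong to pairs that may follow each other in a
  V-path of degree p + 1. An infinite descending chain would thus give V-paths of every length from
  one cell, against the bound at that cell.\<close>

lemma wf_step: "wf (step p)"
  unfolding wf_iff_no_infinite_down_chain
proof
  assume "\<exists>s. \<forall>i. (s (Suc i), s i) \<in> step p"
  then obtain s where s: "\<And>i. (s (Suc i), s i) \<in> step p"
    by blast
  have src: "s i \<in> sources p" for i
    using s[of i] by (simp add: step_def)
  obtain bound :: "'a \<Rightarrow> nat" where bound:
    "\<And>\<sigma> \<pi>. \<lbrakk>\<sigma> \<in> \<beta> p; V_path \<beta> d V (p + 1) \<pi>; \<pi> \<noteq> []; fst (hd \<pi>) = \<sigma>\<rbrakk> \<Longrightarrow> length \<pi> \<le> bound \<sigma>"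
    using admissible unfolding admissible_def by metis
  \<comment> \<open>One more than a V-path from \<open>s 0\<close> may have; being a successor, it
    also makes \<open>\<pi>\<close> nonempty.\<close>
  define n where "n = Suc (bound (s 0))"
  define \<pi> where "\<pi> = map (\<lambda>i. (s i, partner p (s i))) [0..<n]"
  have face: "face \<beta> d (p + 1) (s (Suc i)) (partner p (s i))" for i
  proof -
    have *: "partner p (s i) \<in> \<beta> (p + 1)"
      using partner_in_targets[OF src[of i]] cells_eq by auto
    then have "D (p + 1) (frag_of (partner p (s i))) = d (p + 1) (frag_of (partner p (s i)))"
      by (simp add: D_eq_d)
    with * s[of i] show ?thesis
      using cells_eq by (auto simp: face_def step_def)
  qed
  have "V_path \<beta> d V (p + 1) \<pi>"
    unfolding V_path_def
  proof (intro conjI allI impI)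
    show "set \<pi> \<subseteq> V (p + 1 - 1)"
      using source_pair src by (auto simp: \<pi>_def)
    fix k assume k: "0 < k \<and> k < length \<pi>"
    then obtain j where [simp]: "k = Suc j" by (cases k) auto
    show "face \<beta> d (p + 1) (fst (\<pi> ! k)) (snd (\<pi> ! (k - 1)))"
      using k face by (simp add: \<pi>_def del: upt_Suc)
    show "fst (\<pi> ! k) \<noteq> fst (\<pi> ! (k - 1))"
      using k s[of j] by (simp add: \<pi>_def step_def del: upt_Suc)
  qed
  moreover have "\<pi> \<noteq> []" "fst (hd \<pi>) = s 0"
    by (simp_all add: \<pi>_def n_def hd_map del: upt_Suc)
  moreover have "s 0 \<in> \<beta> p"
    using src cells_eq by blast
  ultimately have "length \<pi> \<le> bound (s 0)"
    using bound by blast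
  then show False
    by (simp add: \<pi>_def n_def)
qed

section \<open>Recursive construction of the homotopy\<close>

text \<open>
  With \<open>\<epsilon> = \<plusminus>1\<close> the coefficient of \<open>\<sigma>\<close> in \<open>d \<tau>\<close>, where \<open>\<tau>\<close> is the partner of \<open>\<sigma>\<close>, solve
  \<open>h (d \<tau>) = \<tau>\<close> for \<open>h \<sigma>\<close>.
\<close>

definition \<eta> :: "int \<Rightarrow> 'a \<Rightarrow> ('a \<Rightarrow>\<^sub>0 int)" where
  "\<eta> p = wfrec (step p) (\<lambda>\<eta> \<sigma>.
     let y = D (p + 1) (frag_of (partner p \<sigma>))
     in frag_cmul (Poly_Mapping.lookup y \<sigma>)
          (frag_of (partner p \<sigma>) - frag_extend \<eta> (frag_proj (sources p - {\<sigma>}) y)))"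

text \<open>Projecting first gives the value 0 off the sources, where \<open>\<eta>\<close> carries
  no meaning.\<close>

definition H :: "int \<Rightarrow> ('a \<Rightarrow>\<^sub>0 int) \<Rightarrow> ('a \<Rightarrow>\<^sub>0 int)" where
  "H p x = frag_extend (\<eta> p) (frag_proj (sources p) x)"

lemma H_additive: "H p 0 = 0" "H p (x + y) = H p x + H p y" "H p (x - y) = H p x - H p y"
  by (simp_all add: H_def frag_proj_add frag_proj_diff frag_extend_add frag_extend_diff)

lemma H_cmul: "H p (frag_cmul c x) = frag_cmul c (H p x)"
proof -
  have "frag_proj (sources p) (frag_cmul c x) = frag_cmul c (frag_proj (sources p) x)"
    by (simp add: frag_proj_def frag_extend_cmul)
  then show ?thesis
    by (simp add: H_def frag_extend_cmul)
qed

lemma H_proj: "H p (frag_proj (sources p) x) = H p x"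
  by (simp add: H_def frag_proj_id[of "frag_proj (sources p) x"])

lemma H_eq_0: "Poly_Mapping.keys x \<inter> sources p = {} \<Longrightarrow> H p x = 0"
  by (simp add: H_def frag_proj_eq_0)

lemma H_source:
  assumes "\<sigma> \<in> sources p"
  defines "y \<equiv> D (p + 1) (frag_of (partner p \<sigma>))"
  shows "H p (frag_of \<sigma>) = frag_cmul (Poly_Mapping.lookup y \<sigma>)
    (frag_of (partner p \<sigma>) - H p (frag_proj (sources p - {\<sigma>}) y))"
proof -
  let ?z = "frag_proj (sources p - {\<sigma>}) y"
  \<comment> \<open>Every cell in the support of \<open>?z\<close> lies below \<sigma>, so the
    \<open>cut\<close> made by \<open>wfrec\<close> changes no value that is used.\<close>
  have "(\<sigma>', \<sigma>) \<in> step p" if "\<sigma>' \<in> Poly_Mapping.keys ?z" for \<sigma>'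
    using that assms by (auto simp: step_def in_keys_iff)
  then have "frag_extend (cut (\<eta> p) (step p) \<sigma>) ?z = frag_extend (\<eta> p) ?z"
    by (intro frag_extend_eq cut_apply)
  also have "\<dots> = H p ?z"
    by (simp add: H_def frag_proj_id[of ?z] le_infI2)
  finally have "\<eta> p \<sigma> = frag_cmul (Poly_Mapping.lookup y \<sigma>) (frag_of (partner p \<sigma>) - H p ?z)"
    unfolding \<eta>_def by (subst wfrec[OF wf_step]) (simp add: Let_def y_def)
  then show ?thesis
    using assms(1) by (simp add: H_def frag_proj_frag_of)
qed

text \<open>A regular incidence number is its own inverse, which is why \<open>\<eta>\<close>
  multiplies by it where solving for \<open>h \<sigma>\<close> calls for division.\<close>

lemma incidence_square:
  assumes "\<sigma> \<in> sources p"
  defines "\<epsilon> \<equiv> Poly_Mapping.lookup (D (p + 1) (frag_of (partner p \<sigma>))) \<sigma>"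
  shows "\<epsilon> * \<epsilon> = 1"
proof -
  have "regular_face \<beta> d (p + 1) \<sigma> (partner p \<sigma>)"
    using field source_pair[OF assms(1)] unfolding discrete_vector_field_def by blast
  then show ?thesis
    by (auto simp: regular_face_def \<epsilon>_def D_eq_d)
qed

text \<open>Split the source part of the boundary into the \<sigma>-term and the rest z. The
  \<sigma>-term contributes the partner minus \<open>H p z\<close>, since the incidence number
  squares to 1, and z contributes \<open>H p z\<close>.\<close>

lemma H_D_partner:
  assumes "\<sigma> \<in> sources p"
  shows "H p (D (p + 1) (frag_of (partner p \<sigma>))) = frag_of (partner p \<sigma>)"
proof -
  define y where "y = D (p + 1) (frag_of (partner p \<sigma>))"
  have "H p y = H p (frag_proj (sources p) y)"
    by (simp add: H_proj)
  also have "\<dots> = frag_of (partner p \<sigma>)"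
    using incidence_square[OF assms]
    by (simp add: frag_proj_remove[OF assms] H_additive H_cmul H_source[OF assms] flip: y_def)
  finally show ?thesis
    by (simp add: y_def)
qed

text \<open>Induction along \<open>step p\<close>: the recursion combines the partner of \<sigma>
  with values of \<open>H\<close> at lower sources.\<close>

lemma keys_H_source: "\<sigma> \<in> sources p \<Longrightarrow> Poly_Mapping.keys (H p (frag_of \<sigma>)) \<subseteq> targets (p + 1)"
proof (induction \<sigma> rule: wf_induct_rule[OF wf_step[of p]])
  case (1 \<sigma>)
  define y where "y = D (p + 1) (frag_of (partner p \<sigma>))"
  let ?z = "frag_proj (sources p - {\<sigma>}) y"
  have "Poly_Mapping.keys (H p ?z) \<subseteq> (\<Union>a \<in> Poly_Mapping.keys ?z. Poly_Mapping.keys (\<eta> p a))"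
    using keys_frag_extend[of "\<eta> p" ?z] by (simp add: H_def frag_proj_id[of ?z] le_infI2)
  also have "\<dots> \<subseteq> targets (p + 1)"
  proof (rule UN_least)
    fix a assume a: "a \<in> Poly_Mapping.keys ?z"
    then have "(a, \<sigma>) \<in> step p" "a \<in> sources p"
      using 1 by (auto simp: step_def in_keys_iff y_def)
    then have "Poly_Mapping.keys (H p (frag_of a)) \<subseteq> targets (p + 1)"
      using 1 by blast
    then show "Poly_Mapping.keys (\<eta> p a) \<subseteq> targets (p + 1)"
      using \<open>a \<in> sources p\<close> by (simp add: H_def frag_proj_frag_of)
  qed
  finally have "Poly_Mapping.keys (frag_of (partner p \<sigma>) - H p ?z) \<subseteq> targets (p + 1)"
    using partner_in_targets[OF 1(2)] keys_diff by fastforce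
  then show ?case
    using keys_cmul by (fastforce simp: H_source[OF 1(2)] y_def)
qed

lemma keys_H: "Poly_Mapping.keys (H p x) \<subseteq> targets (p + 1)"
proof -
  have "Poly_Mapping.keys (\<eta> p a) \<subseteq> targets (p + 1)" if "a \<in> sources p" for a
    using keys_H_source[OF that] that by (simp add: H_def frag_proj_frag_of)
  then show ?thesis
    using keys_frag_extend[of "\<eta> p" "frag_proj (sources p) x"] by (fastforce simp: H_def)
qed

lemma H_in_hom: "H p \<in> hom (free_Abelian_group (\<beta> p)) (free_Abelian_group (\<beta> (p + 1)))"
proof (rule homI)
  show "H p x \<in> carrier (free_Abelian_group (\<beta> (p + 1)))" for x
    using keys_H[of p x] cells_eq by auto
qed (simp add: H_additive)

text \<open>Each target is the partner of a source, so linearity reduces this left inverse property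
  to \<open>H_D_partner\<close>.\<close>

lemma H_D_targets:
  assumes "Poly_Mapping.keys t \<subseteq> targets (p + 1)"
  shows "H p (D (p + 1) t) = t"
  using assms
proof (induction t rule: frag_induct)
  case (frag_of \<tau>)
  then obtain \<sigma> where "(\<sigma>, \<tau>) \<in> V p"
    by (auto simp: targets_def)
  then show ?case
    using H_D_partner[of \<sigma> p] by (auto simp: partner_eq sources_def)
qed (simp_all add: D_additive H_additive)

text \<open>A left inverse of a block that is triangular with unit diagonal is also a right inverse.\<close>

lemma sources_D_H:
  "frag_proj (sources p) (D (p + 1) (H p x)) = frag_proj (sources p) x"
proof -
  have *: "frag_proj (sources p) (D (p + 1) (H p (frag_of \<sigma>))) = frag_of \<sigma>"
    if "\<sigma> \<in> sources p" for \<sigma>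
    using that
  proof (induction \<sigma> rule: wf_induct_rule[OF wf_step[of p]])
    case (1 \<sigma>)
    define y where "y = D (p + 1) (frag_of (partner p \<sigma>))"
    define \<epsilon> where "\<epsilon> = Poly_Mapping.lookup y \<sigma>"
    define z where "z = frag_proj (sources p - {\<sigma>}) y"
    define P where "P u = frag_proj (sources p) (D (p + 1) u)" for u
    have P_cmul: "P (frag_cmul c u) = frag_cmul c (P u)" for c u
      by (simp add: P_def D_def frag_proj_def frag_extend_cmul)
    have P_diff: "P (u - v) = P u - P v" for u v
      by (simp add: P_def D_additive frag_proj_diff)
    have "Poly_Mapping.keys z \<subseteq> {a. (a, \<sigma>) \<in> step p}"
      using 1(2) by (auto simp: step_def in_keys_iff y_def z_def)
    \<comment> \<open>The support of z lies below \<sigma>, so the outer induction hypothesis and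
      linearity apply.\<close>
    then have Pz: "P (H p z) = z"
    proof (induction z rule: frag_induct)
      case (frag_of a)
      then have "(a, \<sigma>) \<in> step p" "a \<in> sources p"
        by (auto simp: step_def)
      then show ?case
        using 1(1) by (simp add: P_def)
    qed (simp_all add: P_diff H_additive, simp add: P_def D_additive)
    have "P (H p (frag_of \<sigma>)) = frag_cmul \<epsilon> (P (frag_of (partner p \<sigma>)) - z)"
      by (simp add: H_source[OF 1(2)] P_cmul P_diff Pz flip: y_def z_def \<epsilon>_def)
    \<comment> \<open>The two occurrences of z cancel, and \<epsilon> times \<epsilon> leaves
      \<sigma>.\<close>
    also have "P (frag_of (partner p \<sigma>)) = frag_cmul \<epsilon> (frag_of \<sigma>) + z"
      by (simp add: P_def frag_proj_remove[OF 1(2)] \<epsilon>_def z_def flip: y_def)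
    finally show ?case
      using incidence_square[OF 1(2)] by (simp add: P_def \<epsilon>_def y_def)
  qed
  have "frag_proj (sources p) (D (p + 1) (H p z)) = z" if "Poly_Mapping.keys z \<subseteq> sources p" for z
    using that
    by (induction z rule: frag_induct)
      (simp_all add: D_additive H_additive frag_proj_diff *)
  from this[of "frag_proj (sources p) x"] show ?thesis
    by (simp add: H_proj)
qed


section \<open>The reduction\<close>

text \<open>The values of \<open>H\<close> are combinations of targets, and no target is a
  source.\<close>

lemma H_H: "H (p + 1) (H p x) = 0"
  using keys_H[of p x] disjoint(1)[of "p + 1"] by (intro H_eq_0) auto

lemma H_D_H: "H p (D (p + 1) (H p x)) = H p x"
  by (simp add: H_D_targets keys_H)

text \<open>This and the next two lemmas restate earlier ones with \<open>p - 1 + 1\<close>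
  simplified to \<open>p\<close>, the form in which \<open>H\<close> follows
  \<open>D p\<close>.\<close>

lemma keys_H': "Poly_Mapping.keys (H (p - 1) x) \<subseteq> targets p"
  using keys_H[of "p - 1"] by simp

lemma H_H': "H p (H (p - 1) x) = 0"
  using H_H[of "p - 1"] by simp

lemma H_D_H': "H (p - 1) (D p (H (p - 1) x)) = H (p - 1) x"
  using H_D_H[of "p - 1"] by simp

section \<open>Maps to and from the critical complex, and its differential\<close>

definition F :: "int \<Rightarrow> ('a \<Rightarrow>\<^sub>0 int) \<Rightarrow> ('a \<Rightarrow>\<^sub>0 int)" where
  "F p x = frag_proj (critical p) (x - D (p + 1) (H p x))"

definition G :: "int \<Rightarrow> ('a \<Rightarrow>\<^sub>0 int) \<Rightarrow> ('a \<Rightarrow>\<^sub>0 int)" where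
  "G p y = y - H (p - 1) (D p y)"

text \<open>The differential transported along \<open>F\<close> and \<open>G\<close>. By
  \<open>H_D_G\<close> it equals the critical part of \<open>D p (G p y)\<close>; the form chosen
  lets the chain map laws follow from \<open>G_F\<close>.\<close>

definition D' :: "int \<Rightarrow> ('a \<Rightarrow>\<^sub>0 int) \<Rightarrow> ('a \<Rightarrow>\<^sub>0 int)" where
  "D' p y = F (p - 1) (D p (G p y))"

lemma F_additive: "F p 0 = 0" "F p (x + y) = F p x + F p y" "F p (x - y) = F p x - F p y"
  by (simp_all add: F_def D_additive H_additive frag_proj_add frag_proj_diff algebra_simps)

lemma G_additive: "G p 0 = 0" "G p (x + y) = G p x + G p y"
  by (simp_all add: G_def D_additive H_additive algebra_simps)

lemma keys_F: "Poly_Mapping.keys (F p x) \<subseteq> critical p"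
  by (simp add: F_def)

lemma keys_G: "Poly_Mapping.keys x \<subseteq> \<beta> p \<Longrightarrow> Poly_Mapping.keys (G p x) \<subseteq> \<beta> p"
  using keys_diff[of x "H (p - 1) (D p x)"] keys_H'[of p "D p x"] cells_eq[of p]
  by (auto simp: G_def)

lemma critical_targets: "Poly_Mapping.keys t \<subseteq> targets p \<Longrightarrow> frag_proj (critical p) t = 0"
  using disjoint(2)[of p] by (intro frag_proj_eq_0) blast

lemma H_critical: "Poly_Mapping.keys y \<subseteq> critical p \<Longrightarrow> H p y = 0"
  using disjoint(2)[of p] by (intro H_eq_0) blast

lemma H_G: "Poly_Mapping.keys y \<subseteq> critical p \<Longrightarrow> H p (G p y) = 0"
  by (simp add: G_def H_additive H_H' H_critical)

text \<open>By h d h = h the operator h d is idempotent, and \<open>G\<close> is its complement 1 -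
  h d.\<close>

lemma H_D_G: "H (p - 1) (D p (G p y)) = 0"
  by (simp add: G_def H_additive D_additive H_D_H')

text \<open>\<open>H_G\<close> removes the correction term of \<open>F\<close>, and the projection
  discards the targets that \<open>G\<close> adds to y.\<close>

lemma F_G: "Poly_Mapping.keys y \<subseteq> critical p \<Longrightarrow> F p (G p y) = y"
  by (simp add: F_def H_G D_additive frag_proj_diff critical_targets keys_H' frag_proj_id)
    (simp add: G_def frag_proj_diff critical_targets keys_H' frag_proj_id)

lemma F_H: "F (p + 1) (H p x) = 0"
  by (simp add: F_def H_H D_additive critical_targets keys_H)

text \<open>The right-hand side has no source component and is killed by h d. As h d fixes
  combinations of targets, its target component is -h d of its critical component, which is the
  correction made by \<open>G\<close>.\<close>

lemma G_F:
  assumes "Poly_Mapping.keys x \<subseteq> \<beta> p"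
  shows "G p (F p x) = x - D (p + 1) (H p x) - H (p - 1) (D p x)"
proof -
  let ?S = "frag_proj (sources p)" and ?T = "frag_proj (targets p)" and ?K = "frag_proj (critical p)"
  define y where "y = x - D (p + 1) (H p x) - H (p - 1) (D p x)"
  have "Poly_Mapping.keys (D (p + 1) (H p x)) \<subseteq> \<beta> p" "Poly_Mapping.keys (H (p - 1) (D p x)) \<subseteq> \<beta> p"
    using keys_D[of "p + 1"] keys_H' cells_eq[of p] by auto blast
  then have "Poly_Mapping.keys y \<subseteq> \<beta> p"
    unfolding y_def using assms by (meson keys_diff order_trans Un_least)
  then have "y = frag_proj ((sources p \<union> targets p) \<union> critical p) y"
    by (simp add: frag_proj_id cells_eq)
  then have split: "y = ?S y + ?T y + ?K y"
    by (simp add: frag_proj_Un disjoint)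
  \<comment> \<open>Only x and d h x can have source components, and \<open>sources_D_H\<close>
    makes these agree.\<close>
  have "?S (H (p - 1) (D p x)) = 0"
    using disjoint(1)[of p] keys_H' by (intro frag_proj_eq_0) blast
  then have "?S y = 0"
    by (simp add: y_def frag_proj_diff sources_D_H)
  with split have split: "y = ?T y + ?K y"
    by simp
  have "H (p - 1) (D p y) = 0"
    by (simp add: y_def D_additive H_additive D_D H_D_H')
  moreover have "H (p - 1) (D p (?T y)) = ?T y"
    using H_D_targets[of "?T y" "p - 1"] by simp
  moreover have "H (p - 1) (D p y) = H (p - 1) (D p (?T y)) + H (p - 1) (D p (?K y))"
    by (subst split) (simp add: D_additive H_additive)
  ultimately have "?T y = - H (p - 1) (D p (?K y))"
    by (metis add_eq_0_iff add.commute)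
  with split have "y = G p (?K y)"
    by (simp add: G_def)
  \<comment> \<open>The term h d x consists of targets, so it does not affect the critical
    component.\<close>
  also have "?K y = F p x"
    by (simp add: y_def F_def frag_proj_diff critical_targets keys_H')
  finally show ?thesis
    by (simp add: y_def)
qed

text \<open>Replacing x by its image under 1 - d h - h d changes d x by d h d x, which
  \<open>F\<close> kills because d h d h = d h. With \<open>G_F\<close> this makes \<open>F\<close>
  a chain map.\<close>

lemma F_D: "F (p - 1) (D p x) = F (p - 1) (D p (x - D (p + 1) (H p x) - H (p - 1) (D p x)))"
  by (simp add: F_def D_additive H_additive D_D H_D_H')

lemma D'_F: "Poly_Mapping.keys x \<subseteq> \<beta> p \<Longrightarrow> D' p (F p x) = F (p - 1) (D p x)"
  by (simp add: D'_def G_F flip: F_D)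

text \<open>Expand \<open>G\<close> after \<open>F\<close> by \<open>G_F\<close>: on
  \<open>D p (G p y)\<close> one correction term vanishes by \<open>H_D_G\<close>, the other by d d
  = 0.\<close>

lemma G_D': "Poly_Mapping.keys y \<subseteq> critical p \<Longrightarrow> G (p - 1) (D' p y) = D p (G p y)"
  by (simp add: D'_def G_F keys_D H_D_G D_D D_additive H_additive)

lemma critical_subset: "critical p \<subseteq> \<beta> p"
  by (auto simp: cells_eq)

lemma reduction_F_G_H:
  "reduction (\<lambda>p. free_Abelian_group (\<beta> p)) d
    (\<lambda>p. free_Abelian_group (critical_cells \<beta> V p)) D' F G H"
proof -
  note [simp] = critical_def[symmetric]
  have keys_G': "Poly_Mapping.keys (G p y) \<subseteq> \<beta> p" if "Poly_Mapping.keys y \<subseteq> critical p" for p y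
    using keys_G critical_subset that by blast
  have keys_Hb: "Poly_Mapping.keys (H p x) \<subseteq> \<beta> (p + 1)" for p x
    using keys_H cells_eq by blast
  \<comment> \<open>Since \<open>G\<close> carries \<open>D'\<close> to \<open>D\<close>, the
    composite contains two successive factors \<open>D\<close>.\<close>
  have D'_D': "D' (p - 1) (D' p y) = 0" if "Poly_Mapping.keys y \<subseteq> critical p" for p y
    by (simp add: D'_def[of "p - 1"] G_D' that D_D F_additive)
  have 1: "chain_complex (\<lambda>p. free_Abelian_group (\<beta> p)) d"
    using complex by (simp add: algebraic_cellular_complex_def)
  have 2: "chain_complex (\<lambda>p. free_Abelian_group (critical p)) D'"
    unfolding chain_complex_def
    by (auto simp: abelian_free_Abelian_group D'_D' intro!: homI)
      (auto simp: D'_def G_additive D_additive F_additive dest: subsetD[OF keys_F])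
  have 3: "chain_map (\<lambda>p. free_Abelian_group (\<beta> p)) d (\<lambda>p. free_Abelian_group (critical p)) D' F"
    unfolding chain_map_def
    by (auto simp: D'_F F_additive D_eq_d keys_F intro!: homI dest: subsetD[OF keys_F])
  have 4: "chain_map (\<lambda>p. free_Abelian_group (critical p)) D' (\<lambda>p. free_Abelian_group (\<beta> p)) d G"
    unfolding chain_map_def
    by (auto simp: G_D' G_additive D_eq_d keys_G' intro!: homI dest: subsetD[OF keys_G'])
  have 5: "G p (F p x) + d (p + 1) (H p x) + H (p - 1) (d p x) = x"
    if "Poly_Mapping.keys x \<subseteq> \<beta> p" for p x
    using D_eq_d[OF keys_Hb] by (simp add: G_F D_eq_d that)
  show ?thesis
    unfolding reduction_def
    using 1 2 3 4 5 H_in_hom by (simp add: F_G F_H H_G H_H)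
qed

lemma vector_field_reduction_F_G_H: "vector_field_reduction \<beta> d V D' F G H"
proof -
  have F_target: "F p (frag_of \<tau>) = 0" if "\<tau> \<in> targets p" for p \<tau>
  proof -
    have "\<tau> \<notin> sources p" "\<tau> \<notin> critical p"
      using that disjoint[of p] by auto
    then show ?thesis
      by (simp add: F_def H_eq_0 D_additive frag_proj_frag_of)
  qed
  have F_critical: "F p (frag_of c) = frag_of c" if "c \<in> critical p" for p c
    using that by (simp add: F_def H_critical D_additive frag_proj_frag_of)
  have G_critical: "Poly_Mapping.keys (G p (frag_of c) - frag_of c) \<subseteq> targets p" for p c
    using keys_H' by (simp add: G_def)
  have H_other: "H p (frag_of x) = 0" if "x \<notin> sources p" for p x
    using that by (simp add: H_eq_0)
  have H_source: "Poly_Mapping.keys (H p (frag_of \<sigma>)) \<subseteq> Range (V p)" for p \<sigma>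
    using keys_H[of p] by (simp add: targets_def)
  show ?thesis
    unfolding vector_field_reduction_def
    using reduction_F_G_H F_target F_critical G_critical H_other H_source
    unfolding targets_def sources_def critical_def by simp
qed


section \<open>Uniqueness\<close>

text \<open>The maps are determined in turn: first h, then the composite g f through the homotopy
  identity, then f, g and d'.\<close>

lemma vector_field_reduction_unique:
  assumes "vector_field_reduction \<beta> d V d' f g h"
  shows "Poly_Mapping.keys x \<subseteq> \<beta> p \<Longrightarrow> f p x = F p x"
    and "Poly_Mapping.keys x \<subseteq> \<beta> p \<Longrightarrow> h p x = H p x"
    and "Poly_Mapping.keys y \<subseteq> critical p \<Longrightarrow> g p y = G p y"
    and "Poly_Mapping.keys y \<subseteq> critical p \<Longrightarrow> d' p y = D' p y"
proof -
  have red: "reduction (\<lambda>p. free_Abelian_group (\<beta> p)) d (\<lambda>p. free_Abelian_group (critical p)) d' f g h"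
    and h_source: "\<And>p \<sigma>. \<sigma> \<in> sources p \<Longrightarrow> Poly_Mapping.keys (h p (frag_of \<sigma>)) \<subseteq> targets (p + 1)"
    and h_other: "\<And>p x. \<lbrakk>x \<in> \<beta> p; x \<notin> sources p\<rbrakk> \<Longrightarrow> h p (frag_of x) = 0"
    and g_critical: "\<And>p c. c \<in> critical p \<Longrightarrow> Poly_Mapping.keys (g p (frag_of c) - frag_of c) \<subseteq> targets p"
    using assms
    unfolding vector_field_reduction_def critical_def sources_def targets_def by auto
  have f_hom: "f p \<in> hom (free_Abelian_group (\<beta> p)) (free_Abelian_group (critical p))"
    and g_hom: "g p \<in> hom (free_Abelian_group (critical p)) (free_Abelian_group (\<beta> p))"
    and h_hom: "h p \<in> hom (free_Abelian_group (\<beta> p)) (free_Abelian_group (\<beta> (p + 1)))"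
    and f_chain: "\<And>x. Poly_Mapping.keys x \<subseteq> \<beta> p \<Longrightarrow> f (p - 1) (d p x) = d' p (f p x)"
    and f_g: "\<And>y. Poly_Mapping.keys y \<subseteq> critical p \<Longrightarrow> f p (g p y) = y"
    and homotopy: "\<And>x. Poly_Mapping.keys x \<subseteq> \<beta> p \<Longrightarrow>
      g p (f p x) + d (p + 1) (h p x) + h (p - 1) (d p x) = x" for p
    using red unfolding reduction_def chain_map_def by simp_all
  have keys_f: "Poly_Mapping.keys (f p x) \<subseteq> critical p" if "Poly_Mapping.keys x \<subseteq> \<beta> p" for p x
    using hom_in_carrier[OF f_hom] that by simp
  have keys_h: "Poly_Mapping.keys (h p x) \<subseteq> targets (p + 1)" if "Poly_Mapping.keys x \<subseteq> \<beta> p" for p x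
    using that
  proof (induction x rule: frag_induct)
    case (diff x y)
    then show ?case
      using keys_diff[of "h p x" "h p y"] by (auto simp: hom_frag_diff[OF h_hom])
  next
    case (frag_of a)
    then show ?case
      using h_source[of a p] h_other[of a p] by (cases "a \<in> sources p") auto
  qed (simp add: hom_free_Abelian_group_0[OF h_hom])
  have keys_g: "Poly_Mapping.keys (g p y - y) \<subseteq> targets p"
    if "Poly_Mapping.keys y \<subseteq> critical p" for p y
    using that
  proof (induction y rule: frag_induct)
    case (diff x y)
    then show ?case
      using keys_diff[of "g p x - x" "g p y - y"]
      by (auto simp: hom_frag_diff[OF g_hom] algebra_simps)
  qed (simp_all add: hom_free_Abelian_group_0[OF g_hom] g_critical)
  have h_eq: "h p x = H p x" if "Poly_Mapping.keys x \<subseteq> \<beta> p" for p x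
  proof (rule hom_free_Abelian_group_eqI[OF h_hom H_in_hom _ that])
    fix a assume a: "a \<in> \<beta> p"
    show "h p (frag_of a) = H p (frag_of a)"
    proof (cases "a \<in> sources p")
      case True
      let ?S = "frag_proj (sources p)" and ?x = "frag_of a"
      have S_targets: "?S t = 0" if "Poly_Mapping.keys t \<subseteq> targets p" for t
        using that disjoint(1)[of p] by (intro frag_proj_eq_0) blast
      \<comment> \<open>A critical chain changed by \<open>g\<close> only in targets has no source
        component; this removes the g f term of the homotopy identity.\<close>
      have "Poly_Mapping.keys (f p ?x) \<subseteq> critical p"
        using a by (simp add: keys_f)
      moreover from this have "?S (f p ?x) = 0"
        using disjoint(2)[of p] by (intro frag_proj_eq_0) blast
      ultimately have Sg: "?S (g p (f p ?x)) = 0"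
        using S_targets[OF keys_g, of "f p ?x"] by (simp add: frag_proj_diff)
      have "Poly_Mapping.keys (d p ?x) \<subseteq> \<beta> (p - 1)"
        using a by (simp add: keys_d)
      then have Sh: "?S (h (p - 1) (d p ?x)) = 0"
        using keys_h[of "d p ?x" "p - 1"] by (simp add: S_targets)
      have "?S ?x = ?S (g p (f p ?x) + d (p + 1) (h p ?x) + h (p - 1) (d p ?x))"
        using homotopy[of ?x p] a by simp
      also have "\<dots> = ?S (d (p + 1) (h p ?x))"
        by (simp add: frag_proj_add Sg Sh)
      also have "d (p + 1) (h p ?x) = D (p + 1) (h p ?x)"
        using keys_h[of ?x p] a cells_eq[of "p + 1"] by (intro D_eq_d[symmetric]) auto
      \<comment> \<open>\<open>H\<close> sees only source components, which agree here;
        \<open>H_D_targets\<close> then recovers \<open>h p ?x\<close> on the right.\<close>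
      finally have "H p ?x = H p (D (p + 1) (h p ?x))"
        by (metis H_proj)
      then show ?thesis
        using keys_h[of ?x p] a by (simp add: H_D_targets)
    qed (simp add: a h_other H_eq_0)
  qed
  have gf_eq: "g p (f p x) = G p (F p x)" if x: "Poly_Mapping.keys x \<subseteq> \<beta> p" for p x
  proof -
    have "Poly_Mapping.keys (h p x) \<subseteq> \<beta> (p + 1)"
      using keys_h[OF x] cells_eq by blast
    with x have "g p (f p x) + D (p + 1) (H p x) + H (p - 1) (D p x) = x"
      using homotopy[OF x] by (simp add: h_eq D_eq_d keys_d)
    then show ?thesis
      by (simp add: G_F x algebra_simps)
  qed
  have f_eq: "f p x = F p x" if x: "Poly_Mapping.keys x \<subseteq> \<beta> p" for p x
  proof -
    \<comment> \<open>As \<open>g\<close> adds only targets, the critical part of g f x is f x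
      itself.\<close>
    have "f p x = frag_proj (critical p) (g p (f p x))"
      using critical_targets[OF keys_g[OF keys_f[OF x]]]
      by (simp add: frag_proj_diff frag_proj_id[OF keys_f[OF x]])
    also have "\<dots> = frag_proj (critical p) (G p (F p x))"
      by (simp add: gf_eq x)
    also have "\<dots> = F p x"
      by (simp add: G_def frag_proj_diff critical_targets keys_H' frag_proj_id keys_F)
    finally show ?thesis .
  qed
  have g_eq: "g p y = G p y" if y: "Poly_Mapping.keys y \<subseteq> critical p" for p y
  proof -
    have "Poly_Mapping.keys (G p y) \<subseteq> \<beta> p"
      using y critical_subset keys_G by blast
    \<comment> \<open>At \<open>G p y\<close> the map f, already known to be \<open>F\<close>,
      returns y, so \<open>gf_eq\<close> compares \<open>g p y\<close> with
      \<open>G p y\<close>.\<close>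
    then show ?thesis
      using gf_eq[of "G p y" p] by (simp add: f_eq F_G y)
  qed
  have "d' p y = D' p y" if y: "Poly_Mapping.keys y \<subseteq> critical p" for p y
  proof -
    have G: "Poly_Mapping.keys (G p y) \<subseteq> \<beta> p"
      using y critical_subset keys_G by blast
    \<comment> \<open>Writing y as a value of f lets the chain map law of f compute d'.\<close>
    have "d' p y = d' p (f p (g p y))"
      by (simp add: f_g y)
    also have "\<dots> = D' p y"
      using f_chain[OF G] by (simp add: g_eq y D'_def f_eq G keys_d D_eq_d)
    finally show ?thesis .
  qed
  then show "Poly_Mapping.keys x \<subseteq> \<beta> p \<Longrightarrow> f p x = F p x"
    and "Poly_Mapping.keys x \<subseteq> \<beta> p \<Longrightarrow> h p x = H p x"
    and "Poly_Mapping.keys y \<subseteq> critical p \<Longrightarrow> g p y = G p y"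
    and "Poly_Mapping.keys y \<subseteq> critical p \<Longrightarrow> d' p y = D' p y"
    by (simp_all add: f_eq h_eq g_eq)
qed

end

theorem theorem19:
  fixes \<beta> :: "int \<Rightarrow> 'a set"
    and d :: "int \<Rightarrow> ('a \<Rightarrow>\<^sub>0 int) \<Rightarrow> ('a \<Rightarrow>\<^sub>0 int)"
    and V :: "int \<Rightarrow> ('a \<times> 'a) set"
  assumes "algebraic_cellular_complex \<beta> d"
    and "discrete_vector_field \<beta> d V"
    and "admissible \<beta> d V"
  shows "\<exists>d' f g h.
    vector_field_reduction \<beta> d V d' f g h \<and>
    (\<forall>d'' f' g' h'. vector_field_reduction \<beta> d V d'' f' g' h' \<longrightarrow>
      (\<forall>p. (\<forall>x \<in> carrier (free_Abelian_group (\<beta> p)). f' p x = f p x \<and> h' p x = h p x) \<and>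
           (\<forall>y \<in> carrier (free_Abelian_group (critical_cells \<beta> V p)).
              g' p y = g p y \<and> d'' p y = d' p y)))"
proof -
  interpret vector_field_complex \<beta> d V
    using assms by unfold_locales
  show ?thesis
    using vector_field_reduction_F_G_H vector_field_reduction_unique
    by (intro exI[of _ D'] exI[of _ F] exI[of _ G] exI[of _ H]) (simp flip: critical_def)
qed

end
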